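(* Let $\mathbf{X}=(X_1,\ldots,X_N)^\intercal$ fulfill the assumptions listed in the context, let $y(\mathbf{X})\in L^2(\Omega,\mathcal{F},\mathbb{P})$, and let $y_{\mathbf{p},\boldsymbol{\Xi}}(\mathbf{X})$ be its SCE approximation for a degree $\mathbf{p}\in\mathbb{N}_0^N$ and a family of knot sequences $\boldsymbol{\Xi}$, with expansion coefficients $C_{\mathbf{i},\mathbf{p},\boldsymbol{\Xi}}$, $\mathbf{i}\in\mathcal{I}_{\mathbf{n}}$. Then, with $\mathbf{1}=(1,\ldots,1)$, the mean of the SCE approximation is $$\mathbb{E}[y_{\mathbf{p},\boldsymbol{\Xi}}(\mathbf{X})]=C_{\mathbf{1},\mathbf{p},\boldsymbol{\Xi}}=\mathbb{E}[y(\mathbf{X})],$$ and its variance is $$\operatorname{var}[y_{\mathbf{p},\boldsymbol{\Xi}}(\mathbf{X})]=\sum_{\mathbf{i}\in\mathcal{I}_{\mathbf{n}}\setminus\{\mathbf{1}\}}C_{\mathbf{i},\mathbf{p},\boldsymbol{\Xi}}^2=\sum_{\mathbf{i}\in\mathcal{I}_{\mathbf{n}}}C_{\mathbf{i},\mathbf{p},\boldsymbol{\Xi}}^2-C_{\mathbf{1},\mathbf{p},\boldsymbol{\Xi}}^2.$$ Moreover, $\operatorname{var}[y_{\mathbf{p},\boldsymbol{\Xi}}(\mathbf{X})]\le\operatorname{var}[y(\mathbf{X})]$.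
   Context: Inputs. $\mathbb{N}=\{1,2,\ldots\}$, $\mathbb{N}_0=\mathbb{N}\cup\{0\}$. $(\Omega,\mathcal{F},\mathbb{P})$ is a probability space, $\mathbb{A}^N=\times_{k=1}^N[a_k,b_k]$ with finite reals $a_k<b_k$, $\mathcal{B}^N$ is the Borel $\sigma$-algebra on $\mathbb{A}^N$, and $\mathbf{X}=(X_1,\ldots,X_N)^\intercal:(\Omega,\mathcal{F})\to(\mathbb{A}^N,\mathcal{B}^N)$ is a random vector such that: (1) the $X_k$ are statistically independent (not necessarily identically distributed); (2) each $X_k$ takes values in $[a_k,b_k]$ (so all its moments are finite); (3) each $X_k$ has an absolutely continuous distribution function and a density $f_{X_k}$, continuous on $[a_k,b_k]$, with support $[a_k,b_k]$ (the closure of $\{f_{X_k}>0\}$). The joint density is $f_{\mathbf{X}}(\mathbf{x})=\prod_{k=1}^Nf_{X_k}(x_k)$, with support $\mathbb{A}^N$. $L^2(\Omega,\mathcal{F},\mathbb{P})$ denotes the space of (classes of) random variables $y(\mathbf{X})$, $y:\mathbb{A}^N\to\mathbb{R}$ measurable, with $\mathbb{E}|y(\mathbf{X})|^2<\infty$. Univariate B-splines. For each $k$, let $n_k>p_k\ge0$ be integers and let $\boldsymbol{\xi}_k=\{\xi_{k,1}\le\cdots\le\xi_{k,n_k+p_k+1}\}$ be a $(p_k+1)$-open knot sequence on $[a_k,b_k]$: its distinct values are $a_k=\zeta_{k,1}<\cdots<\zeta_{k,r_k}=b_k$, with multiplicities $m_{k,1}=m_{k,r_k}=p_k+1$ and $1\le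 m_{k,j}\le p_k+1$ for $2\le j\le r_k-1$. B-splines: $B^k_{i,0,\boldsymbol{\xi}_k}(x)=1$ if $\xi_{k,i}\le x<\xi_{k,i+1}$ and $0$ otherwise; for $q\ge1$, $B^k_{i,q,\boldsymbol{\xi}_k}(x)=\frac{x-\xi_{k,i}}{\xi_{k,i+q}-\xi_{k,i}}B^k_{i,q-1,\boldsymbol{\xi}_k}(x)+\frac{\xi_{k,i+q+1}-x}{\xi_{k,i+q+1}-\xi_{k,i+1}}B^k_{i+1,q-1,\boldsymbol{\xi}_k}(x)$, terms with zero denominator being zero; values at $x=b_k$ are taken as left limits. The degree-$p_k$ B-splines are $B^k_{i,p_k,\boldsymbol{\xi}_k}$, $1\le i\le n_k$. Orthonormal B-splines and SCE. $\mathbf{P}_k(x_k)=(1,B^k_{2,p_k,\boldsymbol{\xi}_k}(x_k),\ldots,B^k_{n_k,p_k,\boldsymbol{\xi}_k}(x_k))^\intercal$, $\mathbf{G}_k=\mathbb{E}[\mathbf{P}_k(X_k)\mathbf{P}_k^\intercal(X_k)]$ (symmetric positive-definite), $\mathbf{G}_k=\mathbf{Q}_k\mathbf{Q}_k^\intercal$ is the Cholesky factorization ($\mathbf{Q}_k$ lower triangular with positive diagonal), and $\boldsymbol{\psi}_k(x_k)=(\psi^k_{1,p_k,\boldsymbol{\xi}_k}(x_k),\ldots,\psi^k_{n_k,p_k,\boldsymbol{\xi}_k}(x_k))^\intercal=\mathbf{Q}_k^{-1}\mathbf{P}_k(x_k)$. For $\mathbf{p}=(p_1,\ldots,p_N)$,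 $\boldsymbol{\Xi}=\{\boldsymbol{\xi}_1,\ldots,\boldsymbol{\xi}_N\}$, $\mathbf{n}=(n_1,\ldots,n_N)$ and $\mathcal{I}_{\mathbf{n}}=\{(i_1,\ldots,i_N):1\le i_k\le n_k\}$, put $\Psi_{\mathbf{i},\mathbf{p},\boldsymbol{\Xi}}(\mathbf{x})=\prod_{k=1}^N\psi^k_{i_k,p_k,\boldsymbol{\xi}_k}(x_k)$. The SCE approximation of $y(\mathbf{X})$ is $y_{\mathbf{p},\boldsymbol{\Xi}}(\mathbf{X})=\sum_{\mathbf{i}\in\mathcal{I}_{\mathbf{n}}}C_{\mathbf{i},\mathbf{p},\boldsymbol{\Xi}}\Psi_{\mathbf{i},\mathbf{p},\boldsymbol{\Xi}}(\mathbf{X})$ with $C_{\mathbf{i},\mathbf{p},\boldsymbol{\Xi}}=\mathbb{E}[y(\mathbf{X})\Psi_{\mathbf{i},\mathbf{p},\boldsymbol{\Xi}}(\mathbf{X})]$. *)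

theory Defs
  imports "HOL-Probability.Probability" "Jordan_Normal_Form.Gauss_Jordan_Elimination"
begin

text \<open>Both HOL-Analysis and Jordan-Normal-Form use the dollar sign for vector indexing. Here points of
  Euclidean space are indexed with \<open>$h\<close>, whereas \<open>$\<close> and \<open>$$\<close> refer to Jordan-Normal-Form.\<close>

unbundle no vec_syntax
notation Finite_Cartesian_Product.vec_nth (infixl \<open>$h\<close> 90)
notation Matrix.vec_index (infixl \<open>$\<close> 100)

section \<open>Univariate B-splines\<close>

text \<open>Knots, B-splines and basis functions are indexed from 1.\<close>

definition open_knot_sequence :: "real \<Rightarrow> real \<Rightarrow> nat \<Rightarrow> nat \<Rightarrow> (nat \<Rightarrow> real) \<Rightarrow> bool" where
  "open_knot_sequence a b p n \<xi> \<longleftrightarrow>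
     p < n \<and>
     mono_on {1..n + p + 1} \<xi> \<and> \<xi> 1 = a \<and> \<xi> (n + p + 1) = b \<and>
     card {j \<in> {1..n + p + 1}. \<xi> j = a} = p + 1 \<and>
     card {j \<in> {1..n + p + 1}. \<xi> j = b} = p + 1 \<and>
     (\<forall>i \<in> {1..n + p + 1}. card {j \<in> {1..n + p + 1}. \<xi> j = \<xi> i} \<le> p + 1)"

text \<open>The Cox--de Boor recursion. Terms with zero denominator vanish since \<open>x / 0 = 0\<close>.\<close>

fun bspline :: "(nat \<Rightarrow> real) \<Rightarrow> nat \<Rightarrow> nat \<Rightarrow> real \<Rightarrow> real" where
  "bspline \<xi> i 0 x = (if \<xi> i \<le> x \<and> x < \<xi> (i + 1) then 1 else 0)"
| "bspline \<xi> i (Suc q) x =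
     (x - \<xi> i) / (\<xi> (i + Suc q) - \<xi> i) * bspline \<xi> i q x
     + (\<xi> (i + Suc q + 1) - x) / (\<xi> (i + Suc q + 1) - \<xi> (i + 1)) * bspline \<xi> (i + 1) q x"

text \<open>The recursion yields 0 at the right end point \<open>b\<close>; the value there is the left limit instead.\<close>

definition bspline_closed :: "real \<Rightarrow> (nat \<Rightarrow> real) \<Rightarrow> nat \<Rightarrow> nat \<Rightarrow> real \<Rightarrow> real" where
  "bspline_closed b \<xi> i p x =
     (if x = b then Lim (at_left b) (bspline \<xi> i p) else bspline \<xi> i p x)"

section \<open>Orthonormal B-splines\<close>

text \<open>Entry \<open>j\<close> of a Jordan-Normal-Form vector or matrix (counted from 0) holds the basis function
  number \<open>j + 1\<close>; the first B-spline is replaced by the constant 1.\<close>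

definition aux_bspline_vec ::
    "real \<Rightarrow> nat \<Rightarrow> nat \<Rightarrow> (nat \<Rightarrow> real) \<Rightarrow> real \<Rightarrow> real Matrix.vec" where
  "aux_bspline_vec b p n \<xi> x =
     Matrix.vec n (\<lambda>j. if j = 0 then 1 else bspline_closed b \<xi> (j + 1) p x)"

definition spline_moment_mat ::
    "'w measure \<Rightarrow> ('w \<Rightarrow> real) \<Rightarrow> real \<Rightarrow> nat \<Rightarrow> nat \<Rightarrow> (nat \<Rightarrow> real) \<Rightarrow> real mat" where
  "spline_moment_mat M Z b p n \<xi> =
     mat n n (\<lambda>(i, j). \<integral>\<omega>. aux_bspline_vec b p n \<xi> (Z \<omega>) $ i * aux_bspline_vec b p n \<xi> (Z \<omega>) $ j \<partial>M)"

definition is_cholesky_factor :: "real mat \<Rightarrow> real mat \<Rightarrow> bool" where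
  "is_cholesky_factor G Q \<longleftrightarrow>
     Q \<in> carrier_mat (dim_row G) (dim_row G) \<and>
     (\<forall>i < dim_row G. \<forall>j < dim_row G. i < j \<longrightarrow> Q $$ (i, j) = 0) \<and>
     (\<forall>i < dim_row G. 0 < Q $$ (i, i)) \<and>
     G = Q * transpose_mat Q"

text \<open>A symmetric positive-definite matrix has exactly one such factor.\<close>

definition cholesky_factor :: "real mat \<Rightarrow> real mat" where
  "cholesky_factor G = (THE Q. is_cholesky_factor G Q)"

definition orth_bspline ::
    "'w measure \<Rightarrow> ('w \<Rightarrow> real) \<Rightarrow> real \<Rightarrow> nat \<Rightarrow> nat \<Rightarrow> (nat \<Rightarrow> real) \<Rightarrow> nat \<Rightarrow> real \<Rightarrow> real" where
  "orth_bspline M Z b p n \<xi> i x =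
     (the (mat_inverse (cholesky_factor (spline_moment_mat M Z b p n \<xi>)))
        *\<^sub>v aux_bspline_vec b p n \<xi> x) $ (i - 1)"

section \<open>Spline chaos expansion\<close>

text \<open>The coordinates of the random vector are indexed by a finite type \<open>'n\<close>, so that the dimension
  is \<open>CARD('n)\<close>.\<close>

definition multi_indices :: "('n::finite \<Rightarrow> nat) \<Rightarrow> ('n \<Rightarrow> nat) set" where
  "multi_indices n = {i. \<forall>k. 1 \<le> i k \<and> i k \<le> n k}"

definition tensor_bspline ::
    "'w measure \<Rightarrow> ('w \<Rightarrow> real^'n::finite) \<Rightarrow> real^'n \<Rightarrow> ('n \<Rightarrow> nat) \<Rightarrow> ('n \<Rightarrow> nat) \<Rightarrow>
     ('n \<Rightarrow> nat \<Rightarrow> real) \<Rightarrow> ('n \<Rightarrow> nat) \<Rightarrow> real^'n \<Rightarrow> real" where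
  "tensor_bspline M X b p n \<xi> i x =
     (\<Prod>k\<in>UNIV. orth_bspline M (\<lambda>\<omega>. X \<omega> $h k) (b $h k) (p k) (n k) (\<xi> k) (i k) (x $h k))"

definition sce_coeff ::
    "'w measure \<Rightarrow> ('w \<Rightarrow> real^'n::finite) \<Rightarrow> real^'n \<Rightarrow> ('n \<Rightarrow> nat) \<Rightarrow> ('n \<Rightarrow> nat) \<Rightarrow>
     ('n \<Rightarrow> nat \<Rightarrow> real) \<Rightarrow> (real^'n \<Rightarrow> real) \<Rightarrow> ('n \<Rightarrow> nat) \<Rightarrow> real" where
  "sce_coeff M X b p n \<xi> y i = (\<integral>\<omega>. y (X \<omega>) * tensor_bspline M X b p n \<xi> i (X \<omega>) \<partial>M)"

definition sce ::
    "'w measure \<Rightarrow> ('w \<Rightarrow> real^'n::finite) \<Rightarrow> real^'n \<Rightarrow> ('n \<Rightarrow> nat) \<Rightarrow> ('n \<Rightarrow> nat) \<Rightarrow>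
     ('n \<Rightarrow> nat \<Rightarrow> real) \<Rightarrow> (real^'n \<Rightarrow> real) \<Rightarrow> real^'n \<Rightarrow> real" where
  "sce M X b p n \<xi> y x =
     (\<Sum>i\<in>multi_indices n. sce_coeff M X b p n \<xi> y i * tensor_bspline M X b p n \<xi> i x)"

end

theory Submission
  imports Defs "Jordan_Normal_Form.Determinant"
begin

text \<open>
  The functions \<open>\<Psi>\<^sub>i\<close> form a finite orthonormal family in \<open>L\<^sup>2\<close> whose member with
  index \<open>(1, \<dots>, 1)\<close> is the constant 1, and the expansion is the orthogonal projection of \<open>y(X)\<close> onto
  their span. For such a projection the mean is the coefficient of 1, the variance is the sum of
  the other squared coefficients by Parseval, and the variance of \<open>y(X)\<close> is at least as large by
  Bessel's inequality (lemma \<open>orthonormal_expansion_moments\<close>).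

  The work lies in showing that the family really is orthonormal. Independence of the coordinates
  reduces this to one variable (lemma \<open>tensor_bspline_orthonormal\<close>). There, whitening by the inverse
  Cholesky factor yields an orthonormal family, provided that the factor exists and is unique. It
  does if the moment matrix of \<open>1, B_2, \<dots>, B_n\<close> is positive definite (lemma
  \<open>moment_mat_positive_definite\<close>). Since the density is positive on a dense open subset of \<open>(a, b)\<close>,
  this holds once every nontrivial combination of these functions is nonzero throughout some
  interval (lemma \<open>aux_bspline_vec_independent\<close>). For this, compare orders of vanishing immediately
  to the right of the knot where the first function with nonzero coefficient starts: the leading term
  of that function cannot be cancelled by the later ones (lemma \<open>bspline_leading_term\<close>).
\<close>

section \<open>B-splines near a knot\<close>

lemma bspline_eq_0_left:
  assumes "mono_on {j..j + q} \<xi>" and "x < \<xi> j"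
  shows "bspline \<xi> j q x = 0"
  using assms
proof (induction q arbitrary: j)
  case 0
  then show ?case by simp
next
  case (Suc q)
  have "\<xi> j \<le> \<xi> (j + 1)"
    using Suc.prems(1) by (rule mono_onD) auto
  moreover have "mono_on {j..j + q} \<xi>" "mono_on {j + 1..j + 1 + q} \<xi>"
    by (rule mono_on_subset[OF Suc.prems(1)]; simp)+
  ultimately show ?case
    using Suc.IH[of j] Suc.IH[of "j + 1"] Suc.prems(2) by simp
qed

text \<open>Let \<open>t\<close> be the left end point of the support and \<open>r\<close> the last index with knot value \<open>t\<close>. Immediately
  to the right of \<open>t\<close> the B-spline of degree \<open>q\<close> and index \<open>j\<close> is a positive multiple of
  \<open>(x - t) ^ (q + j - r)\<close> to leading order. Hence among the B-splines that start at the same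
  knot the order of vanishing grows with the index, which is what separates them in the proof of
  linear independence.

  In the recursion, the first summand raises the exponent through its factor \<open>x - t\<close>, and the
  second has the right exponent because its index is larger by one. Both contributions to
  the leading coefficient are nonnegative, and they do not both vanish: the first does only if all
  knots of its B-spline equal \<open>t\<close>, the second only if \<open>r = j\<close>.\<close>

lemma bspline_leading_term:
  assumes "mono_on {j..j + q + 1} \<xi>" and "j \<le> r" and "r \<le> j + q"
    and "\<xi> j = \<xi> r" and "\<xi> r < \<xi> (Suc r)"
  shows "\<exists>C>0. ((\<lambda>x. bspline \<xi> j q x / (x - \<xi> r) ^ (q + j - r)) \<longlongrightarrow> C) (at_right (\<xi> r))"
  using assms
proof (induction q arbitrary: j)
  case 0
  then have r: "r = j" and lt: "\<xi> j < \<xi> (Suc j)" by auto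
  have "eventually (\<lambda>x. x \<in> {\<xi> j<..<\<xi> (Suc j)}) (at_right (\<xi> j))"
    by (rule eventually_at_right_real[OF lt])
  then have "eventually (\<lambda>x. bspline \<xi> j 0 x / (x - \<xi> r) ^ (0 + j - r) = 1) (at_right (\<xi> j))"
    by eventually_elim (auto simp: r)
  then have "((\<lambda>x. bspline \<xi> j 0 x / (x - \<xi> r) ^ (0 + j - r)) \<longlongrightarrow> 1) (at_right (\<xi> r))"
    unfolding r by (rule tendsto_eventually)
  then show ?case by (intro exI[of _ 1]) simp
next
  case (Suc q)
  define t where "t = \<xi> r"
  let ?F = "at_right t"
  let ?e = "Suc q + j - r"
  let ?u = "\<lambda>x. (x - \<xi> j) / (\<xi> (j + Suc q) - \<xi> j) * bspline \<xi> j q x"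
  let ?v = "\<lambda>x. (\<xi> (j + Suc q + 1) - x) / (\<xi> (j + Suc q + 1) - \<xi> (j + 1)) * bspline \<xi> (j + 1) q x"
  have mono: "\<xi> k \<le> \<xi> l" if "j \<le> k" "k \<le> l" "l \<le> j + Suc q + 1" for k l
    using Suc.prems(1) that by (auto simp: mono_on_def)
  have tj: "\<xi> j = t" and lt: "t < \<xi> (Suc r)" using Suc.prems by (auto simp: t_def)
  have gt: "t < \<xi> l" if "r < l" "l \<le> j + Suc q + 1" for l
    using mono[of "Suc r" l] that lt Suc.prems by force
  have right: "eventually (\<lambda>x. x \<in> {t<..<\<xi> (Suc r)}) ?F"
    by (rule eventually_at_right_real[OF lt])
  have u: "\<exists>C\<ge>0. (r \<le> j + q \<longrightarrow> C > 0) \<and> ((\<lambda>x. ?u x / (x - t) ^ ?e) \<longlongrightarrow> C) ?F"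
  proof (cases "r \<le> j + q")
    case True
    obtain C where C: "C > 0" "((\<lambda>x. bspline \<xi> j q x / (x - t) ^ (q + j - r)) \<longlongrightarrow> C) ?F"
      using Suc.IH[of j] mono_on_subset[OF Suc.prems(1), of "{j..j + q + 1}"] Suc.prems True
      by (auto simp: t_def)
    let ?d = "\<xi> (j + Suc q) - t"
    have d: "?d > 0" using gt[of "j + Suc q"] True by simp
    have "((\<lambda>x. bspline \<xi> j q x / (x - t) ^ (q + j - r) / ?d) \<longlongrightarrow> C / ?d) ?F"
      using C(2) d by (intro tendsto_intros) auto
    moreover have "eventually (\<lambda>x. bspline \<xi> j q x / (x - t) ^ (q + j - r) / ?d = ?u x / (x - t) ^ ?e) ?F"
      using right
    proof eventually_elim
      case (elim x)
      have "?e = Suc (q + j - r)" using True by simp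
      then show ?case using elim tj by (simp add: divide_simps)
    qed
    ultimately have "((\<lambda>x. ?u x / (x - t) ^ ?e) \<longlongrightarrow> C / ?d) ?F"
      by (rule Lim_transform_eventually)
    then show ?thesis using C(1) d by (intro exI[of _ "C / ?d"]) auto
  next
    case False
    then have "r = j + Suc q" using Suc.prems by simp
    then have "\<xi> (j + Suc q) = \<xi> j" using Suc.prems by simp
    then show ?thesis using False by (intro exI[of _ 0]) simp
  qed
  have v: "\<exists>C\<ge>0. (j < r \<longrightarrow> C > 0) \<and> ((\<lambda>x. ?v x / (x - t) ^ ?e) \<longlongrightarrow> C) ?F"
  proof (cases "j < r")
    case True
    have eq: "\<xi> (j + 1) = t"
      using mono[of j "j + 1"] mono[of "j + 1" r] True Suc.prems by (auto simp: t_def)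
    obtain C where C: "C > 0" "((\<lambda>x. bspline \<xi> (j + 1) q x / (x - t) ^ ?e) \<longlongrightarrow> C) ?F"
      using Suc.IH[of "j + 1"] mono_on_subset[OF Suc.prems(1), of "{j + 1..j + 1 + q + 1}"]
        Suc.prems True eq
      by (auto simp: t_def)
    let ?k = "\<xi> (j + Suc q + 1)"
    have d: "?k - t > 0" using gt[of "j + Suc q + 1"] Suc.prems by simp
    have "((\<lambda>x. (?k - x) / (?k - t) * (bspline \<xi> (j + 1) q x / (x - t) ^ ?e)) \<longlongrightarrow>
        (?k - t) / (?k - t) * C) ?F"
      using C(2) d by (intro tendsto_intros) auto
    then show ?thesis using C(1) d eq by (intro exI[of _ C]) simp
  next
    case False
    then have r: "r = j" using Suc.prems by simp
    have "bspline \<xi> (j + 1) q x = 0" if "x \<in> {t<..<\<xi> (Suc r)}" for x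
      using that r mono_on_subset[OF Suc.prems(1), of "{j + 1..j + 1 + q}"]
      by (intro bspline_eq_0_left) auto
    then have "eventually (\<lambda>x. ?v x / (x - t) ^ ?e = 0) ?F"
      using right by (auto elim: eventually_mono)
    then have "((\<lambda>x. ?v x / (x - t) ^ ?e) \<longlongrightarrow> 0) ?F"
      by (rule tendsto_eventually)
    then show ?thesis using False by (intro exI[of _ 0]) auto
  qed
  obtain C D where CD: "C \<ge> 0" "D \<ge> 0" "r \<le> j + q \<longrightarrow> C > 0" "j < r \<longrightarrow> D > 0"
    "((\<lambda>x. ?u x / (x - t) ^ ?e) \<longlongrightarrow> C) ?F" "((\<lambda>x. ?v x / (x - t) ^ ?e) \<longlongrightarrow> D) ?F"
    using u v by blast
  have "C + D > 0" using CD(1-4) by (cases "j < r") auto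
  moreover have "((\<lambda>x. bspline \<xi> j (Suc q) x / (x - t) ^ ?e) \<longlongrightarrow> C + D) ?F"
    using tendsto_add[OF CD(5,6)] by (simp add: add_divide_distrib)
  ultimately show ?case by (auto simp: t_def)
qed

lemma bspline_measurable [measurable]: "bspline \<xi> j q \<in> borel_measurable borel"
proof (induction q arbitrary: j)
  case 0
  show ?case by (simp cong: measurable_cong) measurable
next
  case (Suc q)
  note [measurable] = Suc
  show ?case by (simp cong: measurable_cong) measurable
qed

lemma bspline_bounded: "\<exists>C. \<forall>x\<in>{a..b}. \<bar>bspline \<xi> j q x\<bar> \<le> C"
proof (induction q arbitrary: j)
  case 0
  show ?case by (intro exI[of _ 1]) auto
next
  case (Suc q)
  obtain C D where CD: "\<forall>x\<in>{a..b}. \<bar>bspline \<xi> j q x\<bar> \<le> C"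
     "\<forall>x\<in>{a..b}. \<bar>bspline \<xi> (j + 1) q x\<bar> \<le> D" using Suc by meson
  let ?s = "\<bar>a\<bar> + \<bar>b\<bar> + \<bar>\<xi> j\<bar>" and ?t = "\<bar>a\<bar> + \<bar>b\<bar> + \<bar>\<xi> (j + Suc q + 1)\<bar>"
  let ?d = "\<bar>\<xi> (j + Suc q) - \<xi> j\<bar>" and ?e = "\<bar>\<xi> (j + Suc q + 1) - \<xi> (j + 1)\<bar>"
  have "\<bar>bspline \<xi> j (Suc q) x\<bar> \<le> ?s / ?d * C + ?t / ?e * D" if x: "x \<in> {a..b}" for x
  proof -
    have "\<bar>x - \<xi> j\<bar> / ?d * \<bar>bspline \<xi> j q x\<bar> \<le> ?s / ?d * C"
      using x CD by (intro mult_mono divide_right_mono) auto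
    moreover have "\<bar>\<xi> (j + Suc q + 1) - x\<bar> / ?e * \<bar>bspline \<xi> (j + 1) q x\<bar> \<le> ?t / ?e * D"
      using x CD by (intro mult_mono divide_right_mono) auto
    ultimately show ?thesis
      unfolding bspline.simps abs_mult[symmetric] abs_divide[symmetric]
      by (intro order.trans[OF abs_triangle_ineq]) (simp only: abs_mult abs_divide)
  qed
  then show ?case by blast
qed

text \<open>Linear independence of \<open>1, B_2, \<dots>, B_n\<close>, in a form strong enough to see it almost everywhere: a
  nontrivial combination has no zero on some whole interval. Let \<open>i\<close> be the index of the first nonzero
  coefficient and \<open>t\<close> the knot at which this basis function starts. Divide the combination by the
  leading power of \<open>x - t\<close> of that function. As \<open>x\<close> tends to \<open>t\<close> from the right,
  the later B-splines contribute nothing in the limit: they vanish near \<open>t\<close> or have higher order. So the limit is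
  a nonzero multiple of the first nonzero coefficient.\<close>

lemma aux_bspline_vec_independent:
  assumes knots: "open_knot_sequence a b p n \<xi>" and "\<exists>i<n. c i \<noteq> 0"
  shows "\<exists>t u. a \<le> t \<and> t < u \<and> u \<le> b \<and>
    (\<forall>x\<in>{t<..<u}. (\<Sum>i<n. c i * aux_bspline_vec b p n \<xi> x $ i) \<noteq> 0)"
proof -
  let ?m = "n + p + 1"
  have mono_\<xi>: "mono_on {1..?m} \<xi>" and ends: "\<xi> 1 = a" "\<xi> ?m = b"
    and mult: "\<And>i. i \<in> {1..?m} \<Longrightarrow> card {j \<in> {1..?m}. \<xi> j = \<xi> i} \<le> p + 1"
    using knots by (auto simp: open_knot_sequence_def)
  have mono: "\<xi> k \<le> \<xi> l" if "1 \<le> k" "k \<le> l" "l \<le> ?m" for k l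
    using mono_\<xi> that by (auto simp: mono_on_def)
  define s where "s = (LEAST i. c i \<noteq> 0)"
  obtain i0 where "i0 < n" "c i0 \<noteq> 0" using assms(2) by blast
  then have cs: "c s \<noteq> 0" "s < n"
    unfolding s_def using LeastI[of "\<lambda>i. c i \<noteq> 0" i0] Least_le[of "\<lambda>i. c i \<noteq> 0" i0] by simp_all
  have before: "c i = 0" if "i < s" for i
    using that not_less_Least unfolding s_def by blast
  define i where "i = s + 1"
  have i: "1 \<le> i" "i \<le> n" using cs by (auto simp: i_def)
  \<comment> \<open>Otherwise \<open>p + 2\<close> knots would coincide.\<close>
  have step: "\<xi> i < \<xi> (i + p + 1)"
  proof (rule ccontr)
    assume "\<not> ?thesis"
    then have "j \<in> {j \<in> {1..?m}. \<xi> j = \<xi> i}" if "i \<le> j" "j \<le> i + p + 1" for j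
      using mono[of i j] mono[of j "i + p + 1"] i that by auto
    then have "{i..i + p + 1} \<subseteq> {j \<in> {1..?m}. \<xi> j = \<xi> i}"
      unfolding subset_iff atLeastAtMost_iff by blast
    then have "card {i..i + p + 1} \<le> card {j \<in> {1..?m}. \<xi> j = \<xi> i}"
      by (intro card_mono) auto
    then show False using mult[of i] i by simp
  qed
  obtain r where r: "i \<le> r" "r \<le> i + p" "\<xi> i = \<xi> r"
    and max: "\<And>l. i \<le> l \<Longrightarrow> l \<le> i + p \<Longrightarrow> \<xi> i = \<xi> l \<Longrightarrow> l \<le> r"
    using ex_has_greatest_nat[of "\<lambda>l. i \<le> l \<and> l \<le> i + p \<and> \<xi> i = \<xi> l" i "\<lambda>l. l" "i + p + 1"] by auto
  have lt: "\<xi> r < \<xi> (Suc r)"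
  proof (cases "r = i + p")
    case True
    then show ?thesis using step r by simp
  next
    case False
    then have "\<xi> r \<noteq> \<xi> (Suc r)" using max[of "Suc r"] r by auto
    then show ?thesis using mono[of r "Suc r"] r i by simp
  qed
  define t where "t = \<xi> r"
  have t: "a \<le> t" "t < b"
    using mono[of 1 r] mono[of "Suc r" ?m] lt r i by (auto simp: t_def ends[symmetric])
  let ?F = "at_right t"
  \<comment> \<open>The constant 1 takes the place of \<open>B_1\<close> and has exponent 0. For \<open>i = 1\<close> the
    estimate \<open>r \<le> p + 1\<close> then gives every later B-spline a positive exponent at \<open>t\<close>.\<close>
  define e where "e = (if s = 0 then 0 else p + i - r)"
  have lead: "\<exists>C>0. ((\<lambda>x. bspline \<xi> j p x / (x - t) ^ (p + j - r)) \<longlongrightarrow> C) ?F"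
    if "i \<le> j" "j \<le> n" "j \<le> r" for j
    unfolding t_def
  proof (rule bspline_leading_term)
    show "mono_on {j..j + p + 1} \<xi>" by (rule mono_on_subset[OF mono_\<xi>]) (use that i in auto)
    show "\<xi> j = \<xi> r" using mono[of i j] mono[of j r] that r i by auto
  qed (use that r lt in auto)
  have small: "((\<lambda>x. bspline \<xi> j p x / (x - t) ^ e) \<longlongrightarrow> 0) ?F" if j: "i < j" "j \<le> n" for j
  proof (cases "j \<le> r")
    case True
    obtain C where C: "((\<lambda>x. bspline \<xi> j p x / (x - t) ^ (p + j - r)) \<longlongrightarrow> C) ?F"
      using lead[of j] True j by auto
    have e: "e < p + j - r" using j r by (auto simp: e_def i_def)
    have "((\<lambda>x. bspline \<xi> j p x / (x - t) ^ (p + j - r) * (x - t) ^ (p + j - r - e)) \<longlongrightarrow>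
        C * (t - t) ^ (p + j - r - e)) ?F"
      by (intro tendsto_intros C)
    moreover have "eventually (\<lambda>x. bspline \<xi> j p x / (x - t) ^ (p + j - r) * (x - t) ^ (p + j - r - e)
        = bspline \<xi> j p x / (x - t) ^ e) ?F"
      using eventually_at_right_less
    proof eventually_elim
      case (elim x)
      have "(x - t) ^ (p + j - r) = (x - t) ^ (p + j - r - e) * (x - t) ^ e"
        using e by (simp flip: power_add)
      then show ?case using elim by simp
    qed
    ultimately have "((\<lambda>x. bspline \<xi> j p x / (x - t) ^ e) \<longlongrightarrow> C * (t - t) ^ (p + j - r - e)) ?F"
      by (rule Lim_transform_eventually)
    then show ?thesis using e by (auto simp: power_0_left split: if_splits)
  next
    case False
    have "bspline \<xi> j p x = 0" if "x \<in> {t<..<\<xi> (Suc r)}" for x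
    proof (rule bspline_eq_0_left)
      show "mono_on {j..j + p} \<xi>" by (rule mono_on_subset[OF mono_\<xi>]) (use i j in auto)
      show "x < \<xi> j" using that mono[of "Suc r" j] False j i r by auto
    qed
    then have "eventually (\<lambda>x. bspline \<xi> j p x / (x - t) ^ e = 0) ?F"
      using eventually_at_right_real[OF lt] by (auto simp: t_def elim: eventually_mono)
    then show ?thesis by (rule tendsto_eventually)
  qed
  let ?B = "\<lambda>k x. if k = 0 then 1 else bspline \<xi> (k + 1) p x"
  obtain C where C: "C > 0" "((\<lambda>x. ?B s x / (x - t) ^ e) \<longlongrightarrow> C) ?F"
  proof (cases "s = 0")
    case True
    then show ?thesis using that[of 1] by (simp add: e_def)
  next
    case False
    then show ?thesis using that lead[of i] i r by (auto simp: e_def i_def)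
  qed
  have "((\<lambda>x. c k * (?B k x / (x - t) ^ e)) \<longlongrightarrow> (if k = s then c s * C else 0)) ?F" if "k < n" for k
  proof (cases k s rule: linorder_cases)
    case less
    then show ?thesis using before by simp
  next
    case equal
    show ?thesis unfolding equal using tendsto_mult_left[OF C(2), of "c s"] by simp
  next
    case greater
    then show ?thesis using tendsto_mult_left[OF small[of "k + 1"], of "c k"] that by (simp add: i_def)
  qed
  then have "((\<lambda>x. \<Sum>k<n. c k * (?B k x / (x - t) ^ e)) \<longlongrightarrow> (\<Sum>k<n. if k = s then c s * C else 0)) ?F"
    by (intro tendsto_sum) auto
  moreover have "(\<Sum>k<n. if k = s then c s * C else 0) \<noteq> 0" using cs C(1) by simp
  ultimately have "eventually (\<lambda>x. (\<Sum>k<n. c k * (?B k x / (x - t) ^ e)) \<noteq> 0) ?F"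
    by (rule tendsto_imp_eventually_ne)
  moreover have "eventually (\<lambda>x. x \<in> {t<..<b}) ?F"
    by (rule eventually_at_right_real[OF t(2)])
  ultimately have "eventually (\<lambda>x. x < b \<and> (\<Sum>k<n. c k * aux_bspline_vec b p n \<xi> x $ k) \<noteq> 0) ?F"
  proof eventually_elim
    case (elim x)
    have "(\<Sum>k<n. c k * (?B k x / (x - t) ^ e)) = (\<Sum>k<n. c k * ?B k x) / (x - t) ^ e"
      by (simp add: sum_divide_distrib)
    moreover have "(\<Sum>k<n. c k * ?B k x) = (\<Sum>k<n. c k * aux_bspline_vec b p n \<xi> x $ k)"
      using elim by (intro sum.cong) (auto simp: aux_bspline_vec_def bspline_closed_def)
    ultimately show ?case using elim by auto
  qed
  then obtain v where v: "t < v" "\<forall>x>t. x < v \<longrightarrow>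
      x < b \<and> (\<Sum>k<n. c k * aux_bspline_vec b p n \<xi> x $ k) \<noteq> 0"
    unfolding eventually_at_right_field by blast
  then show ?thesis using t by (intro exI[of _ t] exI[of _ "min v b"]) auto
qed

section \<open>Cholesky factorization\<close>

text \<open>One step of elimination: the first column is \<open>G i 0 / sqrt (G 0 0)\<close>, and the remaining columns
  factor the Schur complement of \<open>G 0 0\<close>, which is positive definite again. Working with functions on
  indices instead of matrices makes the passage from \<open>n\<close> to \<open>Suc n\<close> a mere index shift.\<close>

lemma cholesky_exists:
  fixes G :: "nat \<Rightarrow> nat \<Rightarrow> real"
  assumes "\<And>i j. G i j = G j i"
    and "\<And>c. \<exists>i<n. c i \<noteq> 0 \<Longrightarrow> 0 < (\<Sum>i<n. \<Sum>j<n. c i * c j * G i j)"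
  shows "\<exists>L. (\<forall>i j. i < j \<longrightarrow> L i j = 0) \<and> (\<forall>i<n. 0 < L i i) \<and>
    (\<forall>i<n. \<forall>j<n. G i j = (\<Sum>k<n. L i k * L j k))"
  using assms
proof (induction n arbitrary: G)
  case 0
  show ?case by (intro exI[of _ "\<lambda>_ _. 0"]) simp
next
  case (Suc n)
  define g where "g = G 0 0"
  have "0 < (\<Sum>i<Suc n. \<Sum>j<Suc n. of_bool (i = 0) * of_bool (j = 0) * G i j)"
    using Suc.prems(2)[of "\<lambda>i. of_bool (i = 0)"] by simp
  then have g: "0 < g"
    by (simp add: sum.lessThan_Suc_shift g_def del: sum.lessThan_Suc)
  define H where "H i j = G (Suc i) (Suc j) - G (Suc i) 0 * G (Suc j) 0 / g" for i j
  have "0 < (\<Sum>i<n. \<Sum>j<n. c i * c j * H i j)" if c: "\<exists>i<n. c i \<noteq> 0" for c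
  proof -
    \<comment> \<open>The value at 0 minimises the quadratic form of \<open>G\<close> for given remaining coordinates \<open>c\<close>;
      the minimum is the form of the Schur complement \<open>H\<close>.\<close>
    define s where "s = (\<Sum>j<n. c j * G (Suc j) 0)"
    define d where "d i = (case i of 0 \<Rightarrow> - s / g | Suc k \<Rightarrow> c k)" for i
    have d0: "d 0 = - s / g" and dS: "\<And>k. d (Suc k) = c k" by (simp_all add: d_def)
    have "\<exists>i<Suc n. d i \<noteq> 0" using c by (force simp: d_def)
    then have "0 < (\<Sum>i<Suc n. \<Sum>j<Suc n. d i * d j * G i j)"
      by (rule Suc.prems(2))
    also have "\<dots> = d 0 * d 0 * g + (\<Sum>j<n. d 0 * c j * G 0 (Suc j)) +
        ((\<Sum>i<n. c i * d 0 * G (Suc i) 0) + (\<Sum>i<n. \<Sum>j<n. c i * c j * G (Suc i) (Suc j)))"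
      by (simp add: sum.lessThan_Suc_shift dS g_def sum.distrib del: sum.lessThan_Suc)
    also have "(\<Sum>j<n. d 0 * c j * G 0 (Suc j)) = d 0 * s"
      by (simp add: s_def sum_distrib_left mult.assoc Suc.prems(1)[of 0 "Suc _"])
    also have "(\<Sum>i<n. c i * d 0 * G (Suc i) 0) = d 0 * s"
      by (simp add: s_def sum_distrib_left mult_ac)
    also have "(\<Sum>i<n. \<Sum>j<n. c i * c j * G (Suc i) (Suc j)) =
        (\<Sum>i<n. \<Sum>j<n. c i * c j * H i j) + s * s / g"
    proof -
      have "s * s / g = (\<Sum>i<n. \<Sum>j<n. c i * c j * (G (Suc i) 0 * G (Suc j) 0 / g))"
        unfolding s_def sum_product sum_divide_distrib by (intro sum.cong refl) simp
      then show ?thesis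
        by (simp add: H_def right_diff_distrib sum_subtractf)
    qed
    also have "d 0 * d 0 * g + d 0 * s + (d 0 * s + ((\<Sum>i<n. \<Sum>j<n. c i * c j * H i j) + s * s / g)) =
        (\<Sum>i<n. \<Sum>j<n. c i * c j * H i j)"
      using g by (simp add: d0)
    finally show ?thesis .
  qed
  moreover have "H i j = H j i" for i j
    using Suc.prems(1) by (simp add: H_def mult.commute)
  ultimately have "\<exists>L. (\<forall>i j. i < j \<longrightarrow> L i j = 0) \<and> (\<forall>i<n. 0 < L i i) \<and>
      (\<forall>i<n. \<forall>j<n. H i j = (\<Sum>k<n. L i k * L j k))"
    by (intro Suc.IH)
  then obtain L where L: "\<And>i j. i < j \<Longrightarrow> L i j = 0" "\<And>i. i < n \<Longrightarrow> 0 < L i i"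
    "\<And>i j. i < n \<Longrightarrow> j < n \<Longrightarrow> H i j = (\<Sum>k<n. L i k * L j k)"
    by blast
  define K where "K i j = (case j of 0 \<Rightarrow> G i 0 / sqrt g
    | Suc l \<Rightarrow> (case i of 0 \<Rightarrow> 0 | Suc k \<Rightarrow> L k l))" for i j
  have "K i j = 0" if "i < j" for i j
    using that L(1) by (auto simp: K_def split: nat.split)
  moreover have "0 < K i i" if "i < Suc n" for i
    using that L(2) g by (auto simp: K_def g_def[symmetric] split: nat.split)
  moreover have "G i j = (\<Sum>k<Suc n. K i k * K j k)" if "i < Suc n" "j < Suc n" for i j
  proof -
    have "(\<Sum>k<Suc n. K i k * K j k) = G i 0 * G j 0 / g + (\<Sum>k<n. K i (Suc k) * K j (Suc k))"
      using g by (simp add: sum.lessThan_Suc_shift K_def del: sum.lessThan_Suc)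
    also have "\<dots> = G i j"
    proof (cases "i = 0 \<or> j = 0")
      case True
      then show ?thesis using g Suc.prems(1)[of 0 j] by (auto simp: K_def g_def[symmetric])
    next
      case False
      then obtain k l where "i = Suc k" "j = Suc l" by (metis not0_implies_Suc)
      then show ?thesis using that L(3)[of k l] by (simp add: K_def H_def)
    qed
    finally show ?thesis by simp
  qed
  ultimately show ?case by blast
qed

text \<open>The factors agree column by column: if all columns before \<open>j\<close> agree, then so do the products
  \<open>L i j * L j j\<close>; the case \<open>i = j\<close> and the sign of the diagonal determine \<open>L j j\<close>, by which one may
  then divide.\<close>

lemma cholesky_unique:
  fixes L K :: "nat \<Rightarrow> nat \<Rightarrow> real"
  assumes L: "\<And>i j. i < j \<Longrightarrow> j < n \<Longrightarrow> L i j = 0" "\<And>i. i < n \<Longrightarrow> 0 < L i i"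
    and K: "\<And>i j. i < j \<Longrightarrow> j < n \<Longrightarrow> K i j = 0" "\<And>i. i < n \<Longrightarrow> 0 < K i i"
    and eq: "\<And>i j. i < n \<Longrightarrow> j < n \<Longrightarrow> (\<Sum>k<n. L i k * L j k) = (\<Sum>k<n. K i k * K j k)"
    and "i < n" "j < n"
  shows "L i j = K i j"
  using \<open>j < n\<close> \<open>i < n\<close>
proof (induction j arbitrary: i rule: less_induct)
  case (less j)
  have split: "(\<Sum>k<n. A i k * A j k) = (\<Sum>k<j. A i k * A j k) + A i j * A j j"
    if "\<And>k. j < k \<Longrightarrow> k < n \<Longrightarrow> A j k = 0" for A :: "nat \<Rightarrow> nat \<Rightarrow> real" and i
  proof -
    have "(\<Sum>k<n. A i k * A j k) = (\<Sum>k<Suc j. A i k * A j k)"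
      using less.prems that by (intro sum.mono_neutral_right) auto
    then show ?thesis by simp
  qed
  have prod: "L i j * L j j = K i j * K j j" if "i < n" for i
  proof -
    have "(\<Sum>k<j. L i k * L j k) = (\<Sum>k<j. K i k * K j k)"
      using less that by (intro sum.cong) auto
    then show ?thesis using eq[OF that less.prems(1)] split[of L i] split[of K i] L(1) K(1) by simp
  qed
  have "(L j j)\<^sup>2 = (K j j)\<^sup>2" using prod[of j] less.prems by (simp add: power2_eq_square)
  then have "L j j = K j j" using L(2)[of j] K(2)[of j] less.prems by (simp add: power2_eq_iff)
  then show ?case using prod[of i] less.prems K(2)[of j] by simp
qed

text \<open>Existence and uniqueness together show that the definite description in
  \<open>cholesky_factor\<close> denotes a factor.\<close>

lemma is_cholesky_factor_cholesky_factor: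
  assumes "\<And>i j. g i j = g j i"
    and "\<And>c. \<exists>i<n. c i \<noteq> 0 \<Longrightarrow> 0 < (\<Sum>i<n. \<Sum>j<n. c i * c j * g i j)"
  shows "is_cholesky_factor (mat n n (\<lambda>(i, j). g i j)) (cholesky_factor (mat n n (\<lambda>(i, j). g i j)))"
proof -
  let ?G = "mat n n (\<lambda>(i, j). g i j)"
  have iff: "?G = Q * transpose_mat Q \<longleftrightarrow>
      (\<forall>i<n. \<forall>j<n. g i j = (\<Sum>k<n. Q $$ (i, k) * Q $$ (j, k)))"
    if "Q \<in> carrier_mat n n" for Q :: "real mat"
  proof -
    have entry: "(Q * transpose_mat Q) $$ (i, j) = (\<Sum>k<n. Q $$ (i, k) * Q $$ (j, k))"
      if "i < n" "j < n" for i j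
      using \<open>Q \<in> carrier_mat n n\<close> that by (simp add: scalar_prod_def atLeast0LessThan)
    show ?thesis
    proof (intro iffI allI impI)
      fix i j assume "?G = Q * transpose_mat Q" and ij: "i < n" "j < n"
      then have "?G $$ (i, j) = (Q * transpose_mat Q) $$ (i, j)" by (simp only:)
      then show "g i j = (\<Sum>k<n. Q $$ (i, k) * Q $$ (j, k))"
        using ij by (simp only: entry) simp
    next
      assume "\<forall>i<n. \<forall>j<n. g i j = (\<Sum>k<n. Q $$ (i, k) * Q $$ (j, k))"
      then show "?G = Q * transpose_mat Q"
        using \<open>Q \<in> carrier_mat n n\<close> by (intro eq_matI) (simp_all add: entry del: index_mult_mat(1))
    qed
  qed
  have "\<exists>L. (\<forall>i j. i < j \<longrightarrow> L i j = 0) \<and> (\<forall>i<n. 0 < L i i) \<and>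
      (\<forall>i<n. \<forall>j<n. g i j = (\<Sum>k<n. L i k * L j k))"
    using assms by (rule cholesky_exists)
  then obtain L where L: "\<forall>i j. i < j \<longrightarrow> L i j = 0" "\<forall>i<n. 0 < L i i"
    "\<forall>i<n. \<forall>j<n. g i j = (\<Sum>k<n. L i k * L j k)"
    by blast
  have ex: "is_cholesky_factor ?G (mat n n (\<lambda>(i, j). L i j))"
    using L by (auto simp: is_cholesky_factor_def iff)
  have carrier: "Q \<in> carrier_mat n n" and tri: "\<And>i j. i < j \<Longrightarrow> j < n \<Longrightarrow> Q $$ (i, j) = 0"
    and pos: "\<And>i. i < n \<Longrightarrow> 0 < Q $$ (i, i)" if "is_cholesky_factor ?G Q" for Q
    using that by (auto simp: is_cholesky_factor_def)
  have unique: "Q = R" if Q: "is_cholesky_factor ?G Q" and R: "is_cholesky_factor ?G R" for Q R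
  proof -
    note c = carrier[OF Q] carrier[OF R]
    have "Q $$ (i, j) = R $$ (i, j)" if "i < n" "j < n" for i j
    proof (rule cholesky_unique[of n "\<lambda>i j. Q $$ (i, j)" "\<lambda>i j. R $$ (i, j)"])
      fix i j assume ij: "i < n" "j < n"
      have "?G = Q * transpose_mat Q" "?G = R * transpose_mat R"
        using Q R unfolding is_cholesky_factor_def by blast+
      then have "g i j = (\<Sum>k<n. Q $$ (i, k) * Q $$ (j, k))"
        "g i j = (\<Sum>k<n. R $$ (i, k) * R $$ (j, k))"
        using ij iff[OF c(1)] iff[OF c(2)] by blast+
      then show "(\<Sum>k<n. Q $$ (i, k) * Q $$ (j, k)) = (\<Sum>k<n. R $$ (i, k) * R $$ (j, k))"
        by simp
    qed (use that in \<open>simp_all add: tri[OF Q] tri[OF R] pos[OF Q] pos[OF R]\<close>)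
    then show ?thesis using c by (intro eq_matI) auto
  qed
  show ?thesis
    unfolding cholesky_factor_def by (rule theI[of "is_cholesky_factor ?G", OF ex]) (rule unique[OF _ ex])
qed

lemma is_cholesky_factor_mat_inverse:
  assumes Q: "is_cholesky_factor G Q" and G: "G \<in> carrier_mat n n"
  defines "A \<equiv> the (mat_inverse Q)"
  shows "A \<in> carrier_mat n n" and "Q * A = 1\<^sub>m n" and "A * G * transpose_mat A = 1\<^sub>m n"
proof -
  have c: "Q \<in> carrier_mat n n" and tri: "\<And>i j. i < j \<Longrightarrow> j < n \<Longrightarrow> Q $$ (i, j) = 0"
    and pos: "\<And>i. i < n \<Longrightarrow> 0 < Q $$ (i, i)" and eq: "G = Q * transpose_mat Q"
    using Q G by (auto simp: is_cholesky_factor_def)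
  have "det Q = prod_list (diag_mat Q)" using tri c by (rule det_lower_triangular)
  moreover have "0 \<notin> set (diag_mat Q)" using pos c by (force simp: diag_mat_def)
  ultimately have "det Q \<noteq> 0" by (simp add: prod_list_zero_iff)
  then have "Q \<in> Units (ring_mat TYPE(real) n ())" using c by (rule det_non_zero_imp_unit[rotated])
  then have "mat_inverse Q = Some A"
    using mat_inverse(1)[OF c, where b = "()"] by (cases "mat_inverse Q") (auto simp: A_def)
  from mat_inverse(2)[OF c this] have AQ: "A * Q = 1\<^sub>m n" by simp
  from mat_inverse(2)[OF c \<open>mat_inverse Q = Some A\<close>]
  show A: "A \<in> carrier_mat n n" and "Q * A = 1\<^sub>m n" by auto
  have "A * G * transpose_mat A = (A * Q) * (transpose_mat Q * transpose_mat A)"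
    using A c by (simp add: eq assoc_mult_mat[of _ n n _ n _ n])
  also have "transpose_mat Q * transpose_mat A = transpose_mat (A * Q)"
    using A c by (simp add: transpose_mult)
  finally show "A * G * transpose_mat A = 1\<^sub>m n" by (simp add: AQ)
qed

section \<open>Orthonormal B-splines in one variable\<close>

lemma
  fixes c :: "'i \<Rightarrow> 'i \<Rightarrow> real" and F :: "'i \<Rightarrow> 'i \<Rightarrow> 'w \<Rightarrow> real"
  assumes "\<And>i j. i \<in> A \<Longrightarrow> j \<in> A \<Longrightarrow> integrable M (F i j)"
  shows integrable_double_sum: "integrable M (\<lambda>\<omega>. \<Sum>i\<in>A. \<Sum>j\<in>A. c i j * F i j \<omega>)"
    and integral_double_sum: "(\<integral>\<omega>. (\<Sum>i\<in>A. \<Sum>j\<in>A. c i j * F i j \<omega>) \<partial>M) =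
      (\<Sum>i\<in>A. \<Sum>j\<in>A. c i j * (\<integral>\<omega>. F i j \<omega> \<partial>M))"
proof -
  have row: "integrable M (\<lambda>\<omega>. \<Sum>j\<in>A. c i j * F i j \<omega>)" if "i \<in> A" for i
    using assms that by (intro Bochner_Integration.integrable_sum integrable_mult_right)
  then show "integrable M (\<lambda>\<omega>. \<Sum>i\<in>A. \<Sum>j\<in>A. c i j * F i j \<omega>)"
    by (rule Bochner_Integration.integrable_sum)
  have "(\<integral>\<omega>. (\<Sum>j\<in>A. c i j * F i j \<omega>) \<partial>M) = (\<Sum>j\<in>A. c i j * (\<integral>\<omega>. F i j \<omega> \<partial>M))" if "i \<in> A" for i
    using assms that by (subst Bochner_Integration.integral_sum) auto
  then show "(\<integral>\<omega>. (\<Sum>i\<in>A. \<Sum>j\<in>A. c i j * F i j \<omega>) \<partial>M) =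
      (\<Sum>i\<in>A. \<Sum>j\<in>A. c i j * (\<integral>\<omega>. F i j \<omega> \<partial>M))"
    using row by (subst Bochner_Integration.integral_sum) auto
qed

locale spline_variable = prob_space M for M :: "'w measure" +
  fixes Z :: "'w \<Rightarrow> real" and a b :: real and f :: "real \<Rightarrow> real"
    and p n :: nat and \<xi> :: "nat \<Rightarrow> real"
  assumes range: "\<And>\<omega>. \<omega> \<in> space M \<Longrightarrow> Z \<omega> \<in> {a..b}"
    and density: "distributed M lborel Z (\<lambda>t. ennreal (f t))"
    and continuous_density: "continuous_on {a..b} f"
    and support: "closure {t. 0 < f t} = {a..b}"
    and knots: "open_knot_sequence a b p n \<xi>"
begin

abbreviation "basis k x \<equiv> aux_bspline_vec b p n \<xi> x $ k"
abbreviation "\<psi> \<equiv> orth_bspline M Z b p n \<xi>"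

lemma n_pos: "0 < n"
  using knots by (simp add: open_knot_sequence_def)

lemma Z_measurable [measurable]: "Z \<in> borel_measurable M"
  using distributed_measurable[OF density] by simp

lemma integrable_bounded_comp:
  fixes h :: "real \<Rightarrow> real"
  assumes "h \<in> borel_measurable borel" and "\<forall>x\<in>{a..b}. \<bar>h x\<bar> \<le> C"
  shows "integrable M (\<lambda>\<omega>. h (Z \<omega>))"
  by (rule integrable_const_bound[of _ C])
    (use assms range in \<open>auto intro: measurable_compose[OF Z_measurable]\<close>)

lemma basis_measurable [measurable]:
  assumes "k < n" shows "(\<lambda>x. basis k x) \<in> borel_measurable borel"
  using assms by (cases "k = 0") (simp_all add: aux_bspline_vec_def bspline_closed_def)

lemma basis_bounded:
  assumes "k < n" shows "\<exists>C. \<forall>x\<in>{a..b}. \<bar>basis k x\<bar> \<le> C"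
proof (cases "k = 0")
  case True
  then show ?thesis using assms by (intro exI[of _ 1]) (simp add: aux_bspline_vec_def)
next
  case False
  obtain C where C: "\<forall>x\<in>{a..b}. \<bar>bspline \<xi> (k + 1) p x\<bar> \<le> C" using bspline_bounded by blast
  show ?thesis
    using C False assms
    by (intro exI[of _ "max C \<bar>basis k b\<bar>"]) (auto simp: aux_bspline_vec_def bspline_closed_def le_max_iff_disj)
qed

lemma integrable_basis_prod:
  assumes "k < n" "l < n"
  shows "integrable M (\<lambda>\<omega>. basis k (Z \<omega>) * basis l (Z \<omega>))"
proof -
  obtain C D where "\<forall>x\<in>{a..b}. \<bar>basis k x\<bar> \<le> C" "\<forall>x\<in>{a..b}. \<bar>basis l x\<bar> \<le> D"
    using basis_bounded assms by meson
  then have "\<forall>x\<in>{a..b}. \<bar>basis k x * basis l x\<bar> \<le> C * D"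
    by (auto simp: abs_mult intro!: mult_mono order.trans[OF abs_ge_zero])
  then show ?thesis
    by (intro integrable_bounded_comp) (use assms in measurable)
qed

text \<open>Every subinterval of \<open>[a, b]\<close> carries mass: the density is positive somewhere inside because its
  support is all of \<open>[a, b]\<close>, and then on a whole neighbourhood by continuity.\<close>

lemma not_AE_not_in_interval:
  assumes "a \<le> t" "t < u" "u \<le> b"
  shows "\<not> (AE \<omega> in M. Z \<omega> \<notin> {t<..<u})"
proof
  assume AE: "AE \<omega> in M. Z \<omega> \<notin> {t<..<u}"
  have "(t + u) / 2 \<in> {t<..<u} \<inter> closure {t. 0 < f t}" using assms unfolding support by simp
  then have "{t<..<u} \<inter> {t. 0 < f t} \<noteq> {}"
    using open_Int_closure_eq_empty[OF open_greaterThanLessThan, of t u "{t. 0 < f t}"] by blast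
  then obtain s where s: "t < s" "s < u" "0 < f s" by auto
  have "isCont f s"
    using continuous_density s assms by (intro continuous_on_interior[of "{a..b}"]) auto
  then have "eventually (\<lambda>x. 0 < f x) (nhds s)"
    using s(3) order_tendstoD(1) tendsto_at_iff_tendsto_nhds by (metis isContD)
  then obtain d where d: "d > 0" "\<And>x. dist x s < d \<Longrightarrow> 0 < f x"
    unfolding eventually_nhds_metric by blast
  define v w where "v = max t (s - d)" and "w = min u (s + d)"
  let ?W = "{v<..<w}"
  have W: "v < w" "\<And>x. x \<in> ?W \<Longrightarrow> 0 < f x" "?W \<subseteq> {t<..<u}"
    using s d by (auto simp: v_def w_def dist_real_def abs_less_iff)
  have [measurable]: "(\<lambda>t. ennreal (f t)) \<in> borel_measurable borel"
    using distributed_borel_measurable[OF density] by simp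
  have "AE \<omega> in M. Z \<omega> \<notin> ?W" using AE by eventually_elim (use W in auto)
  then have "emeasure M (Z -` ?W \<inter> space M) = 0"
    by (subst (asm) AE_iff_measurable[of "Z -` ?W \<inter> space M"]) auto
  then have "(\<integral>\<^sup>+x. ennreal (f x) * indicator ?W x \<partial>lborel) = 0"
    using distributed_emeasure[OF density, of ?W] by simp
  then have "AE x in lborel. ennreal (f x) * indicator ?W x = 0"
    by (subst (asm) nn_integral_0_iff_AE) auto
  then have "AE x in lborel. x \<notin> ?W"
  proof eventually_elim
    case (elim x)
    then show ?case using W(2)[of x] by (auto simp: ennreal_eq_0_iff)
  qed
  then have "emeasure lborel ?W = 0"
    by (subst (asm) AE_iff_measurable[of ?W]) auto
  then show False using W(1) by simp
qed

text \<open>The quadratic form of the moment matrix at \<open>c\<close> is the second moment of the spline with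
  coefficients \<open>c\<close>. This spline is nonzero throughout some interval, and that interval is hit
  with positive probability.\<close>

lemma moment_mat_positive_definite:
  assumes "\<exists>i<n. c i \<noteq> 0"
  shows "0 < (\<Sum>i<n. \<Sum>j<n. c i * c j * (\<integral>\<omega>. basis i (Z \<omega>) * basis j (Z \<omega>) \<partial>M))"
proof -
  let ?S = "\<lambda>\<omega>. \<Sum>i<n. c i * basis i (Z \<omega>)"
  have sq: "(?S \<omega>)\<^sup>2 = (\<Sum>i<n. \<Sum>j<n. c i * c j * (basis i (Z \<omega>) * basis j (Z \<omega>)))" for \<omega>
    by (simp add: power2_eq_square sum_product mult_ac)
  have int: "integrable M (\<lambda>\<omega>. (?S \<omega>)\<^sup>2)"
    unfolding sq by (intro integrable_double_sum integrable_basis_prod) auto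
  have eq: "(\<Sum>i<n. \<Sum>j<n. c i * c j * (\<integral>\<omega>. basis i (Z \<omega>) * basis j (Z \<omega>) \<partial>M)) = (\<integral>\<omega>. (?S \<omega>)\<^sup>2 \<partial>M)"
    unfolding sq by (intro integral_double_sum[symmetric] integrable_basis_prod) auto
  have ne: "(\<integral>\<omega>. (?S \<omega>)\<^sup>2 \<partial>M) \<noteq> 0"
  proof
    assume "(\<integral>\<omega>. (?S \<omega>)\<^sup>2 \<partial>M) = 0"
    then have AE: "AE \<omega> in M. ?S \<omega> = 0"
      using integral_nonneg_eq_0_iff_AE[OF int] by simp
    obtain t u where tu: "a \<le> t" "t < u" "u \<le> b" "\<forall>x\<in>{t<..<u}. (\<Sum>i<n. c i * basis i x) \<noteq> 0"
      using aux_bspline_vec_independent[OF knots assms] by blast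
    have "AE \<omega> in M. Z \<omega> \<notin> {t<..<u}" using AE by eventually_elim (use tu(4) in blast)
    then show False using not_AE_not_in_interval[OF tu(1-3)] by blast
  qed
  have "0 \<le> (\<integral>\<omega>. (?S \<omega>)\<^sup>2 \<partial>M)" by (rule integral_nonneg_AE) simp
  from this ne[symmetric] show ?thesis unfolding eq by (rule le_neq_trans)
qed

definition moments :: "real mat" where "moments = spline_moment_mat M Z b p n \<xi>"
definition transform :: "real mat" where "transform = the (mat_inverse (cholesky_factor moments))"

lemma moments_index:
  "i < n \<Longrightarrow> j < n \<Longrightarrow> moments $$ (i, j) = (\<integral>\<omega>. basis i (Z \<omega>) * basis j (Z \<omega>) \<partial>M)"
  by (simp add: moments_def spline_moment_mat_def)

lemma moments_carrier: "moments \<in> carrier_mat n n"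
  by (simp add: moments_def spline_moment_mat_def)

lemma is_cholesky_factor_moments: "is_cholesky_factor moments (cholesky_factor moments)"
  unfolding moments_def spline_moment_mat_def
  by (rule is_cholesky_factor_cholesky_factor) (simp add: mult.commute, rule moment_mat_positive_definite)

lemmas transform_props =
  is_cholesky_factor_mat_inverse[OF is_cholesky_factor_moments moments_carrier, folded transform_def]

lemma orth_bspline_eq:
  assumes "i \<in> {1..n}"
  shows "\<psi> i x = (\<Sum>k<n. transform $$ (i - 1, k) * basis k x)"
proof -
  have "i - 1 < n" "aux_bspline_vec b p n \<xi> x \<in> carrier_vec n"
    using assms by (auto simp: aux_bspline_vec_def)
  then show ?thesis
    using transform_props(1)
    by (simp add: orth_bspline_def transform_def[symmetric] moments_def[symmetric] scalar_prod_def
        atLeast0LessThan)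
qed

text \<open>The first basis function is 1, so the top left entry of the moment matrix is 1 and hence also that
  of its Cholesky factor. By triangularity the first row of the factor, and with it the
  first row of the inverse, is the first unit vector.\<close>

lemma orth_bspline_first: "\<psi> 1 x = 1"
proof -
  let ?Q = "cholesky_factor moments"
  have Q: "?Q \<in> carrier_mat n n" and tri: "\<And>j. 0 < j \<Longrightarrow> j < n \<Longrightarrow> ?Q $$ (0, j) = 0"
    and pos: "0 < ?Q $$ (0, 0)" and eq: "moments = ?Q * transpose_mat ?Q"
    using is_cholesky_factor_moments moments_carrier n_pos by (auto simp: is_cholesky_factor_def)
  have row0: "(\<Sum>k<n. ?Q $$ (0, k) * h k) = ?Q $$ (0, 0) * h 0" for h
    using tri n_pos by (subst sum.mono_neutral_right[of _ "{0}"]) auto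
  have "moments $$ (0, 0) = (\<Sum>k<n. ?Q $$ (0, k) * ?Q $$ (0, k))"
    using Q n_pos by (subst eq) (simp add: scalar_prod_def atLeast0LessThan)
  moreover have "moments $$ (0, 0) = 1"
    using n_pos by (simp add: moments_index aux_bspline_vec_def prob_space)
  ultimately have "(?Q $$ (0, 0))\<^sup>2 = 1" by (simp add: row0 power2_eq_square)
  then have Q00: "?Q $$ (0, 0) = 1" using pos by (simp add: power2_eq_1_iff)
  have "transform $$ (0, j) = of_bool (j = 0)" if "j < n" for j
  proof -
    have "(?Q * transform) $$ (0, j) = (\<Sum>k<n. ?Q $$ (0, k) * transform $$ (k, j))"
      using Q transform_props(1) that n_pos by (simp add: scalar_prod_def atLeast0LessThan)
    then show ?thesis using that n_pos by (auto simp: row0 Q00 transform_props(2) split: if_splits)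
  qed
  then have "\<psi> 1 x = (\<Sum>k<n. of_bool (k = 0) * basis k x)"
    using n_pos by (subst orth_bspline_eq) (auto intro!: sum.cong)
  also have "\<dots> = basis 0 x" using n_pos by (simp add: of_bool_def if_distrib[of "\<lambda>c. c * _"] cong: if_cong)
  finally show ?thesis using n_pos by (simp add: aux_bspline_vec_def)
qed

text \<open>With \<open>A\<close> the inverse Cholesky factor and \<open>G\<close> the moment matrix, the moments of
  \<open>\<psi>\<close> are the entries of \<open>A G A\<^sup>T\<close>, which is the identity matrix.\<close>

lemma orth_bspline_orthonormal:
  assumes "i \<in> {1..n}" "j \<in> {1..n}"
  shows "(\<integral>\<omega>. \<psi> i (Z \<omega>) * \<psi> j (Z \<omega>) \<partial>M) = of_bool (i = j)"
proof -
  let ?A = transform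
  have ij: "i - 1 < n" "j - 1 < n" "i - 1 = j - 1 \<longleftrightarrow> i = j" using assms by auto
  have "(\<integral>\<omega>. \<psi> i (Z \<omega>) * \<psi> j (Z \<omega>) \<partial>M) =
      (\<integral>\<omega>. (\<Sum>k<n. \<Sum>l<n. ?A $$ (i - 1, k) * ?A $$ (j - 1, l) * (basis k (Z \<omega>) * basis l (Z \<omega>))) \<partial>M)"
    using assms by (simp add: orth_bspline_eq sum_product mult_ac)
  also have "\<dots> = (\<Sum>k<n. \<Sum>l<n. ?A $$ (i - 1, k) * ?A $$ (j - 1, l) * moments $$ (k, l))"
    by (subst integral_double_sum) (auto simp: integrable_basis_prod moments_index)
  also have "\<dots> = (?A * moments * transpose_mat ?A) $$ (i - 1, j - 1)"
    using ij transform_props(1) moments_carrier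
    by (simp add: scalar_prod_def atLeast0LessThan sum_distrib_left mult_ac)
  also have "\<dots> = of_bool (i = j)" using ij by (simp add: transform_props(3))
  finally show ?thesis .
qed

lemma orth_bspline_measurable:
  assumes "i \<in> {1..n}" shows "\<psi> i \<in> borel_measurable borel"
  unfolding orth_bspline_eq[OF assms, abs_def] by (intro borel_measurable_sum borel_measurable_times) auto

lemma orth_bspline_bounded:
  assumes "i \<in> {1..n}" shows "\<exists>C. \<forall>x\<in>{a..b}. \<bar>\<psi> i x\<bar> \<le> C"
proof -
  obtain C where C: "\<And>k x. k < n \<Longrightarrow> x \<in> {a..b} \<Longrightarrow> \<bar>basis k x\<bar> \<le> C k"
    using basis_bounded by metis
  have "\<bar>\<psi> i x\<bar> \<le> (\<Sum>k<n. \<bar>transform $$ (i - 1, k)\<bar> * C k)" if "x \<in> {a..b}" for x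
    unfolding orth_bspline_eq[OF assms]
    by (rule order.trans[OF sum_abs]) (auto simp: abs_mult intro!: sum_mono mult_left_mono C that)
  then show ?thesis by blast
qed

end

section \<open>Tensor products\<close>

lemma finite_multi_indices: "finite (multi_indices n)"
proof -
  have "multi_indices n = (\<Pi>\<^sub>E k\<in>UNIV. {1..n k})" by (auto simp: multi_indices_def PiE_def)
  then show ?thesis by (simp add: finite_PiE)
qed

locale spline_vector = prob_space M for M :: "'w measure" +
  fixes X :: "'w \<Rightarrow> real^'n::finite" and a b :: "real^'n" and f :: "'n \<Rightarrow> real \<Rightarrow> real"
    and p n :: "'n \<Rightarrow> nat" and \<xi> :: "'n \<Rightarrow> nat \<Rightarrow> real"
  assumes indep: "indep_vars (\<lambda>_. borel) (\<lambda>k \<omega>. X \<omega> $h k) UNIV"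
    and coordinate: "\<And>k. spline_variable M (\<lambda>\<omega>. X \<omega> $h k) (a $h k) (b $h k) (f k) (p k) (n k) (\<xi> k)"
begin

abbreviation "\<psi> k \<equiv> orth_bspline M (\<lambda>\<omega>. X \<omega> $h k) (b $h k) (p k) (n k) (\<xi> k)"
abbreviation "\<Psi> \<equiv> tensor_bspline M X b p n \<xi>"

lemma multi_indicesD: "i \<in> multi_indices n \<Longrightarrow> i k \<in> {1..n k}"
  by (simp add: multi_indices_def)

lemma one_in_multi_indices: "(\<lambda>_. 1) \<in> multi_indices n"
  using spline_variable.n_pos[OF coordinate] by (auto simp: multi_indices_def Suc_le_eq)

lemma tensor_bspline_one: "\<Psi> (\<lambda>_. 1) x = 1"
  unfolding tensor_bspline_def
  by (intro prod.neutral ballI spline_variable.orth_bspline_first[OF coordinate])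

lemma orth_bspline_coordinate_measurable:
  assumes "i \<in> multi_indices n"
  shows "(\<lambda>\<omega>. \<psi> k (i k) (X \<omega> $h k)) \<in> borel_measurable M"
  using spline_variable.orth_bspline_measurable[OF coordinate multi_indicesD[OF assms]]
    spline_variable.Z_measurable[OF coordinate, of k]
  by (rule measurable_compose[rotated])

lemma tensor_bspline_measurable:
  assumes "i \<in> multi_indices n" shows "(\<lambda>\<omega>. \<Psi> i (X \<omega>)) \<in> borel_measurable M"
  unfolding tensor_bspline_def
  by (intro borel_measurable_prod orth_bspline_coordinate_measurable assms)

lemma tensor_bspline_bounded:
  assumes "i \<in> multi_indices n" shows "\<exists>C. \<forall>\<omega>\<in>space M. \<bar>\<Psi> i (X \<omega>)\<bar> \<le> C"
proof -
  obtain C where C: "\<And>k x. x \<in> {a $h k..b $h k} \<Longrightarrow> \<bar>\<psi> k (i k) x\<bar> \<le> C k"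
    using spline_variable.orth_bspline_bounded[OF coordinate multi_indicesD[OF assms]] by metis
  have "\<bar>\<Psi> i (X \<omega>)\<bar> \<le> (\<Prod>k\<in>UNIV. C k)" if "\<omega> \<in> space M" for \<omega>
    unfolding tensor_bspline_def abs_prod
    by (rule prod_mono) (use C spline_variable.range[OF coordinate that] in auto)
  then show ?thesis by blast
qed

text \<open>By independence the moment of two tensor products is the product of the univariate moments.
  These are Kronecker deltas, and their product vanishes as soon as the multi-indices differ
  in one coordinate.\<close>

lemma
  assumes i: "i \<in> multi_indices n" and j: "j \<in> multi_indices n"
  shows integrable_tensor_bspline_prod: "integrable M (\<lambda>\<omega>. \<Psi> i (X \<omega>) * \<Psi> j (X \<omega>))"
    and tensor_bspline_orthonormal: "expectation (\<lambda>\<omega>. \<Psi> i (X \<omega>) * \<Psi> j (X \<omega>)) = of_bool (i = j)"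
proof -
  obtain C D where CD: "\<forall>\<omega>\<in>space M. \<bar>\<Psi> i (X \<omega>)\<bar> \<le> C" "\<forall>\<omega>\<in>space M. \<bar>\<Psi> j (X \<omega>)\<bar> \<le> D"
    using tensor_bspline_bounded i j by meson
  show "integrable M (\<lambda>\<omega>. \<Psi> i (X \<omega>) * \<Psi> j (X \<omega>))"
  proof (rule integrable_const_bound[of _ "C * D"])
    show "AE \<omega> in M. norm (\<Psi> i (X \<omega>) * \<Psi> j (X \<omega>)) \<le> C * D"
      using CD by (auto simp: abs_mult intro!: mult_mono order.trans[OF abs_ge_zero])
  qed (intro borel_measurable_times tensor_bspline_measurable i j)
  let ?h = "\<lambda>k x. \<psi> k (i k) x * \<psi> k (j k) x"
  have h: "?h k \<in> borel_measurable borel" for k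
    by (intro borel_measurable_times spline_variable.orth_bspline_measurable[OF coordinate]
        multi_indicesD i j)
  have one: "expectation (\<lambda>\<omega>. ?h k (X \<omega> $h k)) = of_bool (i k = j k)" for k
    by (intro spline_variable.orth_bspline_orthonormal[OF coordinate] multi_indicesD i j)
  have int: "integrable M (\<lambda>\<omega>. ?h k (X \<omega> $h k))" for k
  proof -
    obtain C D where CD: "\<forall>x\<in>{a $h k..b $h k}. \<bar>\<psi> k (i k) x\<bar> \<le> C"
      "\<forall>x\<in>{a $h k..b $h k}. \<bar>\<psi> k (j k) x\<bar> \<le> D"
      using spline_variable.orth_bspline_bounded[OF coordinate multi_indicesD] i j by meson
    have "\<forall>x\<in>{a $h k..b $h k}. \<bar>?h k x\<bar> \<le> C * D"
      using CD by (auto simp: abs_mult intro!: mult_mono order.trans[OF abs_ge_zero])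
    then show ?thesis
      by (rule spline_variable.integrable_bounded_comp[OF coordinate h])
  qed
  have "expectation (\<lambda>\<omega>. \<Psi> i (X \<omega>) * \<Psi> j (X \<omega>)) = expectation (\<lambda>\<omega>. \<Prod>k\<in>UNIV. ?h k (X \<omega> $h k))"
    by (simp add: tensor_bspline_def prod.distrib)
  also have "\<dots> = (\<Prod>k\<in>UNIV. expectation (\<lambda>\<omega>. ?h k (X \<omega> $h k)))"
    using indep_vars_compose2[OF indep, of ?h "\<lambda>_. borel"] h int
    by (intro indep_vars_lebesgue_integral) auto
  also have "\<dots> = of_bool (i = j)"
    unfolding one by (auto simp: fun_eq_iff prod_zero_iff)
  finally show "expectation (\<lambda>\<omega>. \<Psi> i (X \<omega>) * \<Psi> j (X \<omega>)) = of_bool (i = j)" .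
qed

end

section \<open>Mean and variance of a projection\<close>

text \<open>The probabilistic content of the theorem, for any finite orthonormal family that contains the
  constant 1. Expectation is the inner product with 1, so it picks out the coefficient of 1 both in the
  projection \<open>S\<close> and in \<open>Y\<close>. Orthonormality gives \<open>E S\<^sup>2 = E (Y S) = \<Sum> C\<^sub>i\<^sup>2\<close>; the first value yields the
  variance of \<open>S\<close>, and both together yield Bessel's inequality \<open>0 \<le> E (Y - S)\<^sup>2 = E Y\<^sup>2 - \<Sum> C\<^sub>i\<^sup>2\<close>. Since the
  means agree, this inequality is the comparison of the variances.\<close>

lemma orthonormal_expansion_moments:
  fixes \<Phi> :: "'i \<Rightarrow> 'w \<Rightarrow> real" and Y :: "'w \<Rightarrow> real"
  assumes "prob_space M" and fin: "finite I" and i0: "i0 \<in> I" and one: "\<And>\<omega>. \<Phi> i0 \<omega> = 1"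
    and int: "\<And>i j. i \<in> I \<Longrightarrow> j \<in> I \<Longrightarrow> integrable M (\<lambda>\<omega>. \<Phi> i \<omega> * \<Phi> j \<omega>)"
    and orth: "\<And>i j. i \<in> I \<Longrightarrow> j \<in> I \<Longrightarrow> (\<integral>\<omega>. \<Phi> i \<omega> * \<Phi> j \<omega> \<partial>M) = of_bool (i = j)"
    and Y: "integrable M Y" "integrable M (\<lambda>\<omega>. (Y \<omega>)\<^sup>2)"
    and Y\<Phi>: "\<And>i. i \<in> I \<Longrightarrow> integrable M (\<lambda>\<omega>. Y \<omega> * \<Phi> i \<omega>)"
  defines "C \<equiv> \<lambda>i. \<integral>\<omega>. Y \<omega> * \<Phi> i \<omega> \<partial>M" and "S \<equiv> \<lambda>\<omega>. \<Sum>i\<in>I. (\<integral>\<omega>. Y \<omega> * \<Phi> i \<omega> \<partial>M) * \<Phi> i \<omega>"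
  shows "prob_space.expectation M S = C i0" and "C i0 = prob_space.expectation M Y"
    and "prob_space.variance M S = (\<Sum>i\<in>I - {i0}. (C i)\<^sup>2)"
    and "prob_space.variance M S \<le> prob_space.variance M Y"
proof -
  interpret prob_space M by fact
  have S: "S \<omega> = (\<Sum>i\<in>I. C i * \<Phi> i \<omega>)" for \<omega> by (simp add: S_def C_def)
  have S2: "(S \<omega>)\<^sup>2 = (\<Sum>i\<in>I. \<Sum>j\<in>I. C i * C j * (\<Phi> i \<omega> * \<Phi> j \<omega>))" for \<omega>
    by (simp add: S power2_eq_square sum_product mult_ac)
  have YS: "Y \<omega> * S \<omega> = (\<Sum>i\<in>I. C i * (Y \<omega> * \<Phi> i \<omega>))" for \<omega>
    by (simp add: S sum_distrib_left mult_ac)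
  have \<Phi>: "integrable M (\<Phi> i)" if "i \<in> I" for i using int[OF that i0] by (simp add: one)
  have mean\<Phi>: "expectation (\<Phi> i) = of_bool (i = i0)" if "i \<in> I" for i
    using orth[OF that i0] by (simp add: one)
  have intS: "integrable M S" unfolding S[abs_def] using \<Phi> by auto
  have intS2: "integrable M (\<lambda>\<omega>. (S \<omega>)\<^sup>2)" unfolding S2 by (intro integrable_double_sum int)
  have intYS: "integrable M (\<lambda>\<omega>. Y \<omega> * S \<omega>)" unfolding YS using Y\<Phi> by auto
  have pick: "(\<Sum>i\<in>I. g i * of_bool (i = k)) = g k" if "k \<in> I" for g :: "'i \<Rightarrow> real" and k
    using that fin by (simp add: of_bool_def if_distrib[of "\<lambda>c. _ * c"] cong: if_cong)
  show mean: "expectation S = C i0"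
    unfolding S[abs_def] using \<Phi> i0 by (simp add: Bochner_Integration.integral_sum mean\<Phi> pick)
  show Ci0: "C i0 = expectation Y" by (simp add: C_def one)
  have ES2: "expectation (\<lambda>\<omega>. (S \<omega>)\<^sup>2) = (\<Sum>i\<in>I. (C i)\<^sup>2)"
  proof -
    have "expectation (\<lambda>\<omega>. (S \<omega>)\<^sup>2) = (\<Sum>i\<in>I. \<Sum>j\<in>I. C i * C j * of_bool (j = i))"
      unfolding S2 by (subst integral_double_sum) (auto simp: int orth eq_commute intro!: sum.cong)
    then show ?thesis by (simp add: pick power2_eq_square)
  qed
  have EYS: "expectation (\<lambda>\<omega>. Y \<omega> * S \<omega>) = (\<Sum>i\<in>I. (C i)\<^sup>2)"
    unfolding YS using Y\<Phi> by (simp add: Bochner_Integration.integral_sum C_def power2_eq_square)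
  have "variance S = (\<Sum>i\<in>I. (C i)\<^sup>2) - (C i0)\<^sup>2"
    by (subst variance_eq[OF intS intS2]) (simp add: ES2 mean)
  then show "variance S = (\<Sum>i\<in>I - {i0}. (C i)\<^sup>2)"
    using fin i0 by (simp add: sum_diff1)
  have "0 \<le> expectation (\<lambda>\<omega>. (Y \<omega> - S \<omega>)\<^sup>2)" by simp
  also have "\<dots> = expectation (\<lambda>\<omega>. (Y \<omega>)\<^sup>2 - 2 * (Y \<omega> * S \<omega>) + (S \<omega>)\<^sup>2)"
    by (simp add: power2_diff algebra_simps)
  also have "\<dots> = expectation (\<lambda>\<omega>. (Y \<omega>)\<^sup>2) - (\<Sum>i\<in>I. (C i)\<^sup>2)"
    using Y intS2 intYS by (simp add: ES2 EYS)
  finally show "variance S \<le> variance Y"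
    by (subst (1 2) variance_eq) (use Y intS intS2 in \<open>simp_all add: ES2 mean Ci0\<close>)
qed

section \<open>The spline chaos expansion\<close>

theorem mainTheorem4:
  fixes M :: "'w measure"
    and a b :: "real^'n::finite"
    and X :: "'w \<Rightarrow> real^'n"
    and f :: "'n \<Rightarrow> real \<Rightarrow> real"
    and p n :: "'n \<Rightarrow> nat"
    and \<xi> :: "'n \<Rightarrow> nat \<Rightarrow> real"
    and y :: "real^'n \<Rightarrow> real"
  assumes "prob_space M"
    and "\<And>k. a $h k < b $h k"
    and "X \<in> measurable M (restrict_space borel (cbox a b))"
    and "prob_space.indep_vars M (\<lambda>_. borel) (\<lambda>k \<omega>. X \<omega> $h k) UNIV"
    and "\<And>k. distributed M lborel (\<lambda>\<omega>. X \<omega> $h k) (\<lambda>t. ennreal (f k t))"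
    and "\<And>k t. 0 \<le> f k t"
    and "\<And>k. continuous_on {a $h k..b $h k} (f k)"
    and "\<And>k. closure {t. 0 < f k t} = {a $h k..b $h k}"
    and "\<And>k. open_knot_sequence (a $h k) (b $h k) (p k) (n k) (\<xi> k)"
    and "y \<in> borel_measurable (restrict_space borel (cbox a b))"
    and "integrable M (\<lambda>\<omega>. (y (X \<omega>))\<^sup>2)"
  shows "prob_space.expectation M (\<lambda>\<omega>. sce M X b p n \<xi> y (X \<omega>)) = sce_coeff M X b p n \<xi> y (\<lambda>_. 1)
    \<and> sce_coeff M X b p n \<xi> y (\<lambda>_. 1) = prob_space.expectation M (\<lambda>\<omega>. y (X \<omega>))
    \<and> prob_space.variance M (\<lambda>\<omega>. sce M X b p n \<xi> y (X \<omega>))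
        = (\<Sum>i\<in>multi_indices n - {\<lambda>_. 1}. (sce_coeff M X b p n \<xi> y i)\<^sup>2)
    \<and> (\<Sum>i\<in>multi_indices n - {\<lambda>_. 1}. (sce_coeff M X b p n \<xi> y i)\<^sup>2)
        = (\<Sum>i\<in>multi_indices n. (sce_coeff M X b p n \<xi> y i)\<^sup>2) - (sce_coeff M X b p n \<xi> y (\<lambda>_. 1))\<^sup>2
    \<and> prob_space.variance M (\<lambda>\<omega>. sce M X b p n \<xi> y (X \<omega>))
        \<le> prob_space.variance M (\<lambda>\<omega>. y (X \<omega>))"
proof -
  interpret prob_space M by fact
  have X: "X \<omega> \<in> cbox a b" if "\<omega> \<in> space M" for \<omega>
    using measurable_space[OF assms(3) that] by (simp add: space_restrict_space)
  interpret spline_vector M X a b f p n \<xi>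
  proof
    fix k
    show "X \<omega> $h k \<in> {a $h k..b $h k}" if "\<omega> \<in> space M" for \<omega>
      using X[OF that] by (simp add: mem_box_cart)
  qed (use assms in auto)
  have meas: "(\<lambda>\<omega>. y (X \<omega>)) \<in> borel_measurable M"
    using assms(3,10) by (rule measurable_compose)
  have int: "integrable M (\<lambda>\<omega>. y (X \<omega>))"
    using meas assms(11) by (rule square_integrable_imp_integrable)
  have int\<Psi>: "integrable M (\<lambda>\<omega>. y (X \<omega>) * \<Psi> i (X \<omega>))" if i: "i \<in> multi_indices n" for i
  proof -
    obtain C where C: "\<forall>\<omega>\<in>space M. \<bar>\<Psi> i (X \<omega>)\<bar> \<le> C" using tensor_bspline_bounded[OF i] by blast
    show ?thesis
    proof (rule Bochner_Integration.integrable_bound)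
      show "integrable M (\<lambda>\<omega>. y (X \<omega>) * C)" using int by simp
      show "(\<lambda>\<omega>. y (X \<omega>) * \<Psi> i (X \<omega>)) \<in> borel_measurable M"
        by (intro borel_measurable_times meas tensor_bspline_measurable i)
      have "\<bar>\<Psi> i (X \<omega>)\<bar> \<le> \<bar>C\<bar>" if "\<omega> \<in> space M" for \<omega>
        using C that by force
      then show "AE \<omega> in M. norm (y (X \<omega>) * \<Psi> i (X \<omega>)) \<le> norm (y (X \<omega>) * C)"
        by (intro AE_I2) (simp add: abs_mult mult_left_mono)
    qed
  qed
  note moments = orthonormal_expansion_moments[OF prob_space_axioms finite_multi_indices
      one_in_multi_indices tensor_bspline_one integrable_tensor_bspline_prod
      tensor_bspline_orthonormal int assms(11) int\<Psi>]
  show ?thesis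
    unfolding sce_def sce_coeff_def
    using moments finite_multi_indices[of n] one_in_multi_indices by (simp add: sum_diff1)
qed

end
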